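(* Let $R$ be a factorial domain, and $f\in{\rm Int}(R)^{\bullet}$. (1) If $g\in[\![f]\!]$ and $u\in R$, then $u\mid_{[\![f]\!]}g$ if and only if $u\mid_R d(g)$. (2) $\mathcal{A}([\![f]\!])\cap R=[\![f]\!]\cap\mathcal{A}(R)=\{u\in\mathcal{A}(R)\mid u\mid_R d(f)\}$. (3) If $u\in\mathcal{A}([\![f]\!])\cap R$, then $u[\![f]\!]$ is a radical ideal of $[\![f]\!]$. (4) If $P\in\mathfrak{X}([\![f]\!])$ and $u,w\in P\cap\mathcal{A}(R)$, then $u\simeq_{[\![f]\!]}w$.
   Context: Monoids are commutative and cancellative with identity; for a domain $D$, $D^{\bullet}=D\setminus\{0\}$ is a multiplicative monoid; $\mathcal{A}(\cdot)$ denotes the set of atoms. For a monoid $H$: $x\mid_H y$ means $x\in H$ and $y=cx$ for some $c\in H$; $x\simeq_H y$ means $x=y\varepsilon$ for some unit $\varepsilon\in H^{\times}$. An $s$-ideal is a subset $I\subseteq H$ with $IH=I$ (the empty set is allowed); it is prime if $I\neq H$ and $H\setminus I$ is a submonoid; it is radical if it is an intersection of prime $s$-ideals. $\mathfrak{X}(H)$ is the set of minimal nonempty prime $s$-ideals of $H$. With $K$ a quotient field of $R$ and $X$ an indeterminate over $K$, ${\rm Int}(R)=\{g\in K[X]\mid g(x)\in R\text{ for all }x\in R\}$. For $f\in{\rm Int}(R)^{\bullet}$, $[\![f]\!]=\{g\in{\rm Int}(R)^{\bullet}\mid g\text{ divides }f^k\text{ in }{\rm Int}(R)\text{ for some }k\in\mathbb{N}_0\}$;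 it is known that $[\![f]\!]$ is a Krull monoid. Fix a system $\mathcal{Q}$ of representatives (up to associates) of the prime elements of $R$; for $p\in\mathcal{Q}$, $\mathrm{v}_p:R\to\mathbb{N}_0\cup\{\infty\}$ is the $p$-adic valuation, and $d:{\rm Int}(R)^{\bullet}\to R^{\bullet}$ is defined by $d(g)=\prod_{p\in\mathcal{Q}}p^{\min\{\mathrm{v}_p(g(c))\mid c\in R\}}$. *)

theory Defs
  imports
    "HOL-Library.Extended_Nat"
    "HOL-Computational_Algebra.Computational_Algebra"
begin

text \<open>
  Every monoid below is a submonoid \<open>H\<close> (given as a set) of the multiplicative
  monoid of an ambient commutative ring, so all monoid notions are relative to \<open>H\<close>.
\<close>

definition units_in :: "'a::comm_monoid_mult set \<Rightarrow> 'a set" where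
  "units_in H = {e \<in> H. \<exists>e' \<in> H. e * e' = 1}"

definition dvd_in :: "'a::comm_monoid_mult set \<Rightarrow> 'a \<Rightarrow> 'a \<Rightarrow> bool" where
  "dvd_in H x y \<longleftrightarrow> x \<in> H \<and> (\<exists>c \<in> H. y = c * x)"

definition assoc_in :: "'a::comm_monoid_mult set \<Rightarrow> 'a \<Rightarrow> 'a \<Rightarrow> bool" where
  "assoc_in H x y \<longleftrightarrow> (\<exists>e \<in> units_in H. x = y * e)"

definition atoms_in :: "'a::comm_monoid_mult set \<Rightarrow> 'a set" where
  "atoms_in H = {a \<in> H. a \<notin> units_in H \<and>
     (\<forall>b \<in> H. \<forall>c \<in> H. a = b * c \<longrightarrow> b \<in> units_in H \<or> c \<in> units_in H)}"

definition s_ideal :: "'a::comm_monoid_mult set \<Rightarrow> 'a set \<Rightarrow> bool" where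
  "s_ideal H I \<longleftrightarrow> I \<subseteq> H \<and> {x * h | x h. x \<in> I \<and> h \<in> H} = I"

definition prime_s_ideal :: "'a::comm_monoid_mult set \<Rightarrow> 'a set \<Rightarrow> bool" where
  "prime_s_ideal H P \<longleftrightarrow> s_ideal H P \<and> P \<noteq> H \<and>
     1 \<in> H - P \<and> (\<forall>x \<in> H - P. \<forall>y \<in> H - P. x * y \<in> H - P)"

text \<open>Intersections are taken inside \<open>H\<close>: the empty family has intersection \<open>H\<close>.\<close>

definition radical_s_ideal :: "'a::comm_monoid_mult set \<Rightarrow> 'a set \<Rightarrow> bool" where
  "radical_s_ideal H I \<longleftrightarrow> s_ideal H I \<and>
     (\<exists>\<P>. (\<forall>P \<in> \<P>. prime_s_ideal H P) \<and> I = H \<inter> \<Inter>\<P>)"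

definition min_primes :: "'a::comm_monoid_mult set \<Rightarrow> 'a set set" where
  "min_primes H = {P. prime_s_ideal H P \<and> P \<noteq> {} \<and>
     (\<forall>P'. prime_s_ideal H P' \<and> P' \<noteq> {} \<and> P' \<subseteq> P \<longrightarrow> P' = P)}"

text \<open>
  The quotient field of \<open>R = 'a\<close> is \<open>'a fract\<close>, and \<open>R\<close> is embedded in \<open>K[X]\<close> by \<open>const_of\<close>.
\<close>

definition const_of :: "'a::idom \<Rightarrow> 'a fract poly" where
  "const_of u = [:to_fract u:]"

definition Int_polys :: "'a::idom fract poly set" where
  "Int_polys = {g. \<forall>x. poly g (to_fract x) \<in> range to_fract}"

definition div_closed_submonoid :: "'a::idom fract poly \<Rightarrow> 'a fract poly set" where
  "div_closed_submonoid f = {g \<in> Int_polys - {0}. \<exists>k. dvd_in Int_polys g (f ^ k)}"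

definition prime_representatives :: "'a::comm_semiring_1 set \<Rightarrow> bool" where
  "prime_representatives Q \<longleftrightarrow> (\<forall>q \<in> Q. prime_elem q) \<and>
     (\<forall>p. prime_elem p \<longrightarrow> (\<exists>!q. q \<in> Q \<and> p dvd q \<and> q dvd p))"

text \<open>The library's \<open>multiplicity p 0\<close> is \<open>0\<close>, whereas the valuation of \<open>0\<close> is \<open>\<infinity>\<close>.\<close>

definition padic_val :: "'a::{factorial_semiring, idom} \<Rightarrow> 'a \<Rightarrow> enat" where
  "padic_val p x = (if x = 0 then \<infinity> else enat (multiplicity p x))"

text \<open>
  For \<open>g\<close> in \<open>Int_polys\<close> every \<open>c\<close> contributes exactly one element \<open>r = g(c)\<close> of \<open>R\<close>.
  The infimum is a minimum, since \<open>enat\<close> is well-ordered.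
\<close>

definition min_val :: "'a::{factorial_semiring, idom} \<Rightarrow> 'a fract poly \<Rightarrow> enat" where
  "min_val p g = Inf {padic_val p r | r c. to_fract r = poly g (to_fract c)}"

text \<open>
  Primes with exponent \<open>0\<close> are left out of the product because \<open>prod\<close> over an infinite set
  is \<open>1\<close>. For nonzero \<open>g\<close> in \<open>Int_polys\<close> the remaining primes are finitely many and all
  exponents are finite: if \<open>R\<close> has a prime element, it is infinite, so \<open>g(c) \<noteq> 0\<close> for some \<open>c\<close>.
\<close>

definition fixed_div :: "'a::{factorial_semiring, idom} set \<Rightarrow> 'a fract poly \<Rightarrow> 'a" where
  "fixed_div Q g = (\<Prod>p \<in> {p \<in> Q. min_val p g \<noteq> 0}. p ^ the_enat (min_val p g))"

end

theory Submission
  imports Defs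
begin

text \<open>
  For \<open>u \<noteq> 0\<close> in \<open>R\<close>, division by \<open>u\<close> in \<open>\<lbrakk>f\<rbrakk>\<close> is detected by values: \<open>u\<close> divides \<open>g\<close> if and
  only if \<open>u\<close> divides \<open>g(c)\<close> for every \<open>c \<in> R\<close>, and the latter means that \<open>u\<close> divides \<open>d(g)\<close>.
  As irreducible elements of \<open>R\<close> are prime, (2) follows, and \<open>u\<lbrakk>f\<rbrakk>\<close> is the intersection of the
  prime ideals \<open>{h. u dvd h(c)}\<close>, \<open>c \<in> R\<close>, which is (3).

  For (4), let \<open>u\<close> and \<open>w\<close> lie in a minimal prime \<open>P\<close>. Then \<open>u\<close> divides some \<open>s w\<^sup>n\<close> with
  \<open>s \<notin> P\<close>: otherwise the non-divisors of all these products would be a nonempty prime ideal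
  inside \<open>P\<close> that does not contain \<open>w\<close>. If \<open>u\<close> did not divide \<open>w\<close> in \<open>R\<close>, then it would divide all
  values of \<open>s\<close>, whence \<open>s \<in> u\<lbrakk>f\<rbrakk> \<subseteq> P\<close>. This avoids the theory of Krull monoids.
\<close>

section \<open>Prime ideals of monoids\<close>

lemma s_idealI:
  assumes "I \<subseteq> H" "1 \<in> H" "\<And>x h. x \<in> I \<Longrightarrow> h \<in> H \<Longrightarrow> x * h \<in> I"
  shows "s_ideal H I"
proof -
  have "\<exists>y h. x = y * h \<and> y \<in> I \<and> h \<in> H" if "x \<in> I" for x
    using that assms(2) by (metis mult.right_neutral)
  then show ?thesis
    using assms unfolding s_ideal_def by blast
qed

lemma s_ideal_mult:
  assumes "s_ideal H I" "x \<in> I" "h \<in> H"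
  shows "x * h \<in> I"
  using assms unfolding s_ideal_def by blast

lemma prime_s_idealI:
  assumes "s_ideal H I" "1 \<in> H" "1 \<notin> I" "\<And>x y. x \<in> H \<Longrightarrow> y \<in> H \<Longrightarrow> x * y \<in> H"
    and "\<And>x y. x \<in> H \<Longrightarrow> y \<in> H \<Longrightarrow> x * y \<in> I \<Longrightarrow> x \<in> I \<or> y \<in> I"
  shows "prime_s_ideal H I"
  using assms unfolding prime_s_ideal_def by blast

text \<open>In the localization of \<open>H\<close> at a minimal prime \<open>P\<close>, the
  extension of \<open>P\<close> is the only nonempty prime, so some power of \<open>w\<close> is a
  multiple of \<open>u\<close> there. Clearing the denominator \<open>s\<close> brings this back to
  \<open>H\<close>.\<close>

lemma min_prime_dvd_power:
  assumes P: "P \<in> min_primes H" and u: "u \<in> P" and w: "w \<in> P"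
    and one: "1 \<in> H" and mult: "\<And>x y. x \<in> H \<Longrightarrow> y \<in> H \<Longrightarrow> x * y \<in> H"
  shows "\<exists>s \<in> H - P. \<exists>n. dvd_in H u (s * w ^ n)"
proof (rule ccontr)
  assume contr: "\<not> ?thesis"
  \<comment> \<open>\<open>P'\<close> is the complement of the divisor-closed submonoid generated by
    \<open>H - P\<close> and \<open>w\<close>, hence a prime ideal. The exponent 0 places it inside
    \<open>P\<close>, and the exponent 1 keeps \<open>w\<close> out of it.\<close>
  define P' where "P' = {h \<in> H. \<forall>s \<in> H - P. \<forall>n. \<not> dvd_in H h (s * w ^ n)}"
  from P have prime: "prime_s_ideal H P"
    and min: "\<And>P'. prime_s_ideal H P' \<Longrightarrow> P' \<noteq> {} \<Longrightarrow> P' \<subseteq> P \<Longrightarrow> P' = P"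
    unfolding min_primes_def by blast+
  have sub: "P \<subseteq> H" and one_P: "1 \<in> H - P"
    and compl: "\<And>x y. x \<in> H - P \<Longrightarrow> y \<in> H - P \<Longrightarrow> x * y \<in> H - P"
    using prime unfolding prime_s_ideal_def s_ideal_def by blast+
  have dvd_self: "dvd_in H x x" if "x \<in> H" for x
    using that one unfolding dvd_in_def by (metis mult_1)
  have "s_ideal H P'"
  proof (rule s_idealI)
    fix x h assume x: "x \<in> P'" and h: "h \<in> H"
    have "dvd_in H x y" if "dvd_in H (x * h) y" for y
    proof -
      from that obtain c where "c \<in> H" "y = c * (x * h)" unfolding dvd_in_def by blast
      then have "c * h \<in> H" "y = (c * h) * x" using mult h by (auto simp: ac_simps)
      then show ?thesis using x unfolding P'_def dvd_in_def by blast
    qed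
    then show "x * h \<in> P'" using x h mult unfolding P'_def by blast
  qed (use one in \<open>auto simp: P'_def\<close>)
  moreover have "1 \<notin> P'"
  proof -
    have "dvd_in H 1 (1 * w ^ 0)" using dvd_self[OF one] by simp
    then show ?thesis using one_P unfolding P'_def by blast
  qed
  moreover have "x \<in> P' \<or> y \<in> P'" if x: "x \<in> H" and y: "y \<in> H" and xy: "x * y \<in> P'" for x y
  proof (rule ccontr)
    assume "\<not> ?thesis"
    with x y obtain s m t n where st: "s \<in> H - P" "t \<in> H - P"
      and dvd: "dvd_in H x (s * w ^ m)" "dvd_in H y (t * w ^ n)"
      unfolding P'_def by blast
    from dvd obtain c d where "c \<in> H" "d \<in> H" "s * w ^ m = c * x" "t * w ^ n = d * y"
      unfolding dvd_in_def by blast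
    moreover from this have "(s * t) * w ^ (m + n) = (c * d) * (x * y)"
      by (metis (no_types, lifting) mult.assoc mult.commute mult.left_commute power_add)
    ultimately have "dvd_in H (x * y) ((s * t) * w ^ (m + n))"
      using mult x y unfolding dvd_in_def by blast
    then show False using xy compl[OF st] unfolding P'_def by blast
  qed
  ultimately have "prime_s_ideal H P'"
    using one mult by (intro prime_s_idealI) auto
  moreover have "u \<in> P'"
    using contr u sub unfolding P'_def by blast
  moreover have "P' \<subseteq> P"
  proof
    fix h assume h: "h \<in> P'"
    then have "dvd_in H h (h * w ^ 0)" using dvd_self unfolding P'_def by simp
    then show "h \<in> P" using h unfolding P'_def by blast
  qed
  ultimately have "P' = P" using min by blast
  moreover have "w \<notin> P'"
  proof -
    have "dvd_in H w (1 * w ^ 1)" using dvd_self w sub by auto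
    then show ?thesis using one_P unfolding P'_def by blast
  qed
  ultimately show False using w by blast
qed

section \<open>Integer-valued polynomials\<close>

lemma const_of_1 [simp]: "const_of 1 = 1"
  by (simp add: const_of_def one_pCons)

lemma const_of_mult: "const_of (u * v) = const_of u * const_of v"
  by (simp add: const_of_def)

lemma const_of_eq_iff [simp]: "const_of u = const_of v \<longleftrightarrow> u = v"
  by (simp add: const_of_def)

lemma const_of_eq_0_iff [simp]: "const_of u = 0 \<longleftrightarrow> u = 0"
  by (simp add: const_of_def)

text \<open>Divisibility is trivial in the quotient field, so values are pulled back to
  \<open>R\<close> along the injective \<open>to_fract\<close>. The result is determined as soon as
  g(c) lies in \<open>R\<close>, in particular for \<open>g\<close> in
  \<open>Int_polys\<close>.\<close>

definition int_value :: "'a::idom fract poly \<Rightarrow> 'a \<Rightarrow> 'a" where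
  "int_value g c = (THE r. to_fract r = poly g (to_fract c))"

lemma int_value_eqI:
  assumes "to_fract r = poly g (to_fract c)"
  shows "int_value g c = r"
  unfolding int_value_def using assms by (intro the_equality) (auto simp flip: assms)

lemma to_fract_int_value:
  assumes "g \<in> Int_polys"
  shows "to_fract (int_value g c) = poly g (to_fract c)"
proof -
  obtain r where "to_fract r = poly g (to_fract c)"
    using assms unfolding Int_polys_def by (metis (mono_tags, lifting) mem_Collect_eq rangeE)
  then show ?thesis using int_value_eqI by metis
qed

lemma int_value_mult:
  assumes "g \<in> Int_polys" "h \<in> Int_polys"
  shows "int_value (g * h) c = int_value g c * int_value h c"
  using assms by (intro int_value_eqI) (simp add: to_fract_int_value)

lemma int_value_const_of [simp]: "int_value (const_of u) c = u"
  by (intro int_value_eqI) (simp add: const_of_def)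

lemma Int_polysI:
  assumes "\<And>c. \<exists>r. poly g (to_fract c) = to_fract r"
  shows "g \<in> Int_polys"
  using assms unfolding Int_polys_def by auto

lemma const_of_Int_polys [simp]: "const_of u \<in> Int_polys"
  by (auto simp: Int_polys_def const_of_def)

lemma one_Int_polys [simp]: "1 \<in> Int_polys"
  using const_of_Int_polys[of 1] by simp

lemma mult_Int_polys:
  assumes "g \<in> Int_polys" "h \<in> Int_polys"
  shows "g * h \<in> Int_polys"
proof (rule Int_polysI)
  fix c
  have "poly (g * h) (to_fract c) = to_fract (int_value g c * int_value h c)"
    using assms by (simp add: to_fract_int_value)
  then show "\<exists>r. poly (g * h) (to_fract c) = to_fract r" ..
qed

lemma power_Int_polys:
  assumes "g \<in> Int_polys"
  shows "g ^ n \<in> Int_polys"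
  using assms by (induction n) (auto intro: mult_Int_polys)

lemma int_value_power:
  assumes "g \<in> Int_polys"
  shows "int_value (g ^ n) c = int_value g c ^ n"
  using assms int_value_const_of[of 1 c]
  by (induction n) (auto simp: int_value_mult power_Int_polys)

text \<open>The coefficient of a constant polynomial is its value at 0, and integer-valuedness puts
  that value into \<open>R\<close>.\<close>

lemma const_Int_polysE:
  assumes "g \<in> Int_polys" "degree g = 0"
  obtains r where "g = const_of r"
proof -
  from assms(2) obtain a where "g = [:a:]" by (rule degree_eq_zeroE)
  then have "g = const_of (int_value g 0)"
    using to_fract_int_value[OF assms(1), of 0] by (simp add: const_of_def)
  then show ?thesis by (rule that)
qed

text \<open>The only candidate for the quotient is g/u in K[X]. It is integer-valued exactly when
  \<open>u\<close> divides every value of \<open>g\<close>.\<close>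

lemma Int_polys_dvd_const_iff:
  assumes g: "g \<in> Int_polys" and u: "u \<noteq> 0"
  shows "(\<exists>h \<in> Int_polys. g = h * const_of u) \<longleftrightarrow> (\<forall>c. u dvd int_value g c)"
proof
  assume "\<exists>h \<in> Int_polys. g = h * const_of u"
  then show "\<forall>c. u dvd int_value g c" by (auto simp: int_value_mult)
next
  assume dvd: "\<forall>c. u dvd int_value g c"
  define h where "h = smult (inverse (to_fract u)) g"
  have "g = h * const_of u" using u by (simp add: h_def const_of_def)
  moreover have "h \<in> Int_polys"
  proof (rule Int_polysI)
    fix c
    from dvd obtain r where "int_value g c = u * r" by (meson dvdE)
    then have "poly g (to_fract c) = to_fract u * to_fract r"
      using to_fract_int_value[OF g, of c] by simp
    then have "poly h (to_fract c) = to_fract r" using u by (simp add: h_def)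
    then show "\<exists>r. poly h (to_fract c) = to_fract r" ..
  qed
  ultimately show "\<exists>h \<in> Int_polys. g = h * const_of u" by blast
qed

section \<open>The divisor-closed submonoid generated by a polynomial\<close>

lemma div_closed_submonoid_Int_polys:
  assumes "g \<in> div_closed_submonoid f"
  shows "g \<in> Int_polys" "g \<noteq> 0"
  using assms by (auto simp: div_closed_submonoid_def)

lemma one_div_closed_submonoid: "1 \<in> div_closed_submonoid f"
  unfolding div_closed_submonoid_def dvd_in_def
  by (auto intro!: exI[of _ 0] bexI[of _ 1])

lemma mult_div_closed_submonoid:
  assumes "g \<in> div_closed_submonoid f" "h \<in> div_closed_submonoid f"
  shows "g * h \<in> div_closed_submonoid f"
proof -
  from assms obtain k l a b where "a \<in> Int_polys" "b \<in> Int_polys" "f ^ k = a * g" "f ^ l = b * h"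
    unfolding div_closed_submonoid_def dvd_in_def by blast
  moreover from this have "f ^ (k + l) = (a * b) * (g * h)" by (simp add: power_add ac_simps)
  ultimately have "dvd_in Int_polys (g * h) (f ^ (k + l))"
    using assms by (auto simp: dvd_in_def intro: mult_Int_polys div_closed_submonoid_Int_polys)
  then show ?thesis
    using assms unfolding div_closed_submonoid_def by (auto intro: mult_Int_polys)
qed

text \<open>Each factor divides the same power of \<open>f\<close>, the other factor being absorbed
  into the cofactor. This divisor-closedness makes divisibility in
  \<open>\<lbrakk>f\<rbrakk>\<close> agree with divisibility in \<open>Int_polys\<close>.\<close>

lemma divisor_div_closed_submonoid:
  assumes "g * h \<in> div_closed_submonoid f" "g \<in> Int_polys" "h \<in> Int_polys"
  shows "g \<in> div_closed_submonoid f" "h \<in> div_closed_submonoid f"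
proof -
  from assms obtain k a where a: "a \<in> Int_polys" "f ^ k = a * (g * h)" "g * h \<noteq> 0"
    unfolding div_closed_submonoid_def dvd_in_def by blast
  then have "f ^ k = (a * h) * g" "f ^ k = (a * g) * h" by (simp_all add: ac_simps)
  then have "dvd_in Int_polys g (f ^ k)" "dvd_in Int_polys h (f ^ k)"
    using a assms(2,3) mult_Int_polys unfolding dvd_in_def by blast+
  then show "g \<in> div_closed_submonoid f" "h \<in> div_closed_submonoid f"
    using a(3) assms(2,3) unfolding div_closed_submonoid_def by auto
qed

text \<open>Divisor-closedness transfers the value criterion from \<open>Int_polys\<close>. The
  condition \<open>u \<noteq> 0\<close> matters on the right: over a finite field a nonzero
  \<open>g\<close> can vanish at every point, and then 0 divides all its values.\<close>

lemma div_closed_submonoid_dvd_const_iff: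
  assumes g: "g \<in> div_closed_submonoid f"
  shows "dvd_in (div_closed_submonoid f) (const_of u) g \<longleftrightarrow>
    u \<noteq> 0 \<and> (\<forall>c. u dvd int_value g c)"
proof (cases "u = 0")
  case True
  then show ?thesis
    by (auto simp: dvd_in_def dest: div_closed_submonoid_Int_polys)
next
  case False
  have "dvd_in (div_closed_submonoid f) (const_of u) g \<longleftrightarrow> (\<exists>h \<in> Int_polys. g = h * const_of u)"
    using g divisor_div_closed_submonoid[of _ "const_of u" f] div_closed_submonoid_Int_polys
    unfolding dvd_in_def by (metis const_of_Int_polys)
  with False show ?thesis
    using Int_polys_dvd_const_iff div_closed_submonoid_Int_polys(1)[OF g] by blast
qed

section \<open>Units and atoms among the constants\<close>

lemma units_div_closed_submonoid:
  fixes f :: "'a::idom fract poly"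
  shows "units_in (div_closed_submonoid f) = const_of ` {u. u dvd 1}"
proof (intro equalityI subsetI)
  fix e assume "e \<in> units_in (div_closed_submonoid f)"
  then obtain e' where e: "e \<in> Int_polys" "e' \<in> Int_polys" and inv: "e * e' = 1"
    unfolding units_in_def by (auto dest: div_closed_submonoid_Int_polys)
  \<comment> \<open>Degrees add over a domain, so a unit and its inverse are both constant, and
    integer-valued constants come from \<open>R\<close>.\<close>
  from inv have "e \<noteq> 0" "e' \<noteq> 0" by auto
  then have "degree e + degree e' = degree (e * e')" by (simp add: degree_mult_eq)
  with inv have "degree e = 0" "degree e' = 0" by simp_all
  then obtain r r' where r: "e = const_of r" "e' = const_of r'"
    using e const_Int_polysE by metis
  then have "const_of (r * r') = const_of 1" using inv by (simp add: const_of_mult)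
  then have "r * r' = 1" by (subst (asm) const_of_eq_iff)
  then show "e \<in> const_of ` {u. u dvd 1}" using r by (auto simp: dvd_def)
next
  fix e :: "'a fract poly"
  assume "e \<in> const_of ` {u. u dvd 1}"
  then obtain u v where e: "e = const_of u" and uv: "u * v = 1" by (auto elim!: dvdE)
  then have eq: "const_of u * const_of v = 1" by (simp flip: const_of_mult)
  then show "e \<in> units_in (div_closed_submonoid f)"
    using divisor_div_closed_submonoid[of "const_of u" "const_of v" f]
      one_div_closed_submonoid e
    unfolding units_in_def by auto
qed

lemma const_of_unit_iff:
  "const_of u \<in> units_in (div_closed_submonoid f) \<longleftrightarrow> u dvd 1"
  by (auto simp: units_div_closed_submonoid)

text \<open>A constant has the same factorizations in \<open>\<lbrakk>f\<rbrakk>\<close> as in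
  \<open>R\<close>: its factors in \<open>R\<close> stay in the monoid by divisor-closedness, and
  its factors in the monoid are constants by degree. The units agree as well.\<close>

lemma const_of_atom_iff:
  "const_of u \<in> atoms_in (div_closed_submonoid f) \<longleftrightarrow>
    const_of u \<in> div_closed_submonoid f \<and> irreducible u"
proof (intro iffI conjI)
  assume atom: "const_of u \<in> atoms_in (div_closed_submonoid f)"
  then show mem: "const_of u \<in> div_closed_submonoid f" by (simp add: atoms_in_def)
  show "irreducible u"
  proof (rule irreducibleI)
    show "u \<noteq> 0" using div_closed_submonoid_Int_polys(2)[OF mem] by simp
    show "\<not> u dvd 1" using atom by (simp add: atoms_in_def const_of_unit_iff)
  next
    fix a b assume u: "u = a * b"
    then have "const_of a \<in> div_closed_submonoid f" "const_of b \<in> div_closed_submonoid f"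
      using mem divisor_div_closed_submonoid[of "const_of a" "const_of b" f]
      by (auto simp: const_of_mult)
    then show "a dvd 1 \<or> b dvd 1"
      using atom const_of_unit_iff[of _ f] unfolding u atoms_in_def const_of_mult by blast
  qed
next
  assume u: "const_of u \<in> div_closed_submonoid f \<and> irreducible u"
  show "const_of u \<in> atoms_in (div_closed_submonoid f)"
    unfolding atoms_in_def
  proof (intro CollectI conjI ballI impI)
    fix b c
    assume b: "b \<in> div_closed_submonoid f" and c: "c \<in> div_closed_submonoid f"
      and eq: "const_of u = b * c"
    have "degree b + degree c = degree (b * c)"
      using b c by (intro degree_mult_eq[symmetric]) (auto dest: div_closed_submonoid_Int_polys)
    also have "\<dots> = 0" by (simp flip: eq add: const_of_def)
    finally obtain r s where rs: "b = const_of r" "c = const_of s"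
      using b c const_Int_polysE div_closed_submonoid_Int_polys(1) by (metis add_is_0)
    with eq have "u = r * s" by (simp flip: const_of_mult)
    then show "b \<in> units_in (div_closed_submonoid f) \<or> c \<in> units_in (div_closed_submonoid f)"
      using u rs by (auto simp: const_of_unit_iff dest: irreducibleD)
  qed (use u in \<open>auto simp: const_of_unit_iff irreducible_def\<close>)
qed

section \<open>Prime elements of \<open>R\<close> in the monoid\<close>

lemma prime_const_of_mem_iff:
  assumes f: "f \<in> Int_polys - {0}" and u: "prime_elem u"
  shows "const_of u \<in> div_closed_submonoid f \<longleftrightarrow> (\<forall>c. u dvd int_value f c)"
proof
  assume "const_of u \<in> div_closed_submonoid f"
  then obtain k h where "h \<in> Int_polys" "f ^ k = h * const_of u"
    unfolding div_closed_submonoid_def dvd_in_def by blast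
  then have "u dvd int_value (f ^ k) c" for c by (simp add: int_value_mult)
  \<comment> \<open>Evaluation turns \<open>f ^ k\<close> into a power of f(c), and primality of
    \<open>u\<close> removes the exponent. Conversely, the exponent 1 will suffice.\<close>
  then show "\<forall>c. u dvd int_value f c"
    using u f by (auto simp: int_value_power intro: prime_elem_dvd_power)
next
  assume "\<forall>c. u dvd int_value f c"
  moreover have "u \<noteq> 0" using u by (rule prime_elem_not_zeroI)
  ultimately have "dvd_in Int_polys (const_of u) (f ^ 1)"
    using Int_polys_dvd_const_iff[of f u] f by (auto simp: dvd_in_def)
  then show "const_of u \<in> div_closed_submonoid f"
    using \<open>u \<noteq> 0\<close> unfolding div_closed_submonoid_def
    by (metis (mono_tags, lifting) CollectI DiffI const_of_Int_polys const_of_eq_0_iff singletonD)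
qed

text \<open>This is the preimage of the prime ideal generated by \<open>u\<close> under the
  multiplicative map evaluating at \<open>c\<close>.\<close>

lemma prime_s_ideal_int_value:
  assumes "prime_elem u"
  shows "prime_s_ideal (div_closed_submonoid f)
    {h \<in> div_closed_submonoid f. u dvd int_value h c}"
proof (rule prime_s_idealI)
  show "s_ideal (div_closed_submonoid f) {h \<in> div_closed_submonoid f. u dvd int_value h c}"
    by (rule s_idealI)
      (auto simp: one_div_closed_submonoid int_value_mult div_closed_submonoid_Int_polys
        intro: mult_div_closed_submonoid)
  show "1 \<notin> {h \<in> div_closed_submonoid f. u dvd int_value h c}"
    using int_value_const_of[of 1 c] prime_elem_not_unit[OF assms] by simp
qed (use assms in \<open>auto simp: one_div_closed_submonoid int_value_mult
    div_closed_submonoid_Int_polys prime_elem_dvd_mult_iff intro: mult_div_closed_submonoid\<close>)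

lemma radical_prime_const:
  assumes mem: "const_of u \<in> div_closed_submonoid f" and u: "prime_elem u"
  shows "radical_s_ideal (div_closed_submonoid f) ((\<lambda>h. const_of u * h) ` div_closed_submonoid f)"
proof -
  let ?H = "div_closed_submonoid f"
  have "(\<lambda>h. const_of u * h) ` ?H = {g \<in> ?H. dvd_in ?H (const_of u) g}"
    using mem by (auto simp: dvd_in_def mult.commute intro: mult_div_closed_submonoid)
  \<comment> \<open>The value criterion splits divisibility by \<open>u\<close> into one prime ideal
    for each point \<open>c\<close>.\<close>
  also have "\<dots> = ?H \<inter> (\<Inter>c. {h \<in> ?H. u dvd int_value h c})"
    using prime_elem_not_zeroI[OF u] by (auto simp: div_closed_submonoid_dvd_const_iff)
  finally have "(\<lambda>h. const_of u * h) ` ?H = ?H \<inter> \<Inter> (range (\<lambda>c. {h \<in> ?H. u dvd int_value h c}))" .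
  moreover have "s_ideal ?H ((\<lambda>h. const_of u * h) ` ?H)"
    by (rule s_idealI)
      (use mem in \<open>auto simp: one_div_closed_submonoid mult.assoc intro: mult_div_closed_submonoid\<close>)
  moreover have "\<forall>P \<in> range (\<lambda>c. {h \<in> ?H. u dvd int_value h c}). prime_s_ideal ?H P"
    using prime_s_ideal_int_value[OF u] by blast
  ultimately show ?thesis unfolding radical_s_ideal_def by blast
qed

lemma prime_const_dvd_if_min_prime:
  assumes P: "P \<in> min_primes (div_closed_submonoid f)"
    and mem: "const_of u \<in> P" "const_of w \<in> P" and u: "prime_elem u"
  shows "u dvd w"
proof (rule ccontr)
  assume ndvd: "\<not> u dvd w"
  let ?H = "div_closed_submonoid f"
  from P have ideal: "s_ideal ?H P"
    by (simp add: min_primes_def prime_s_ideal_def)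
  then have w: "const_of w \<in> ?H" using mem by (auto simp: s_ideal_def)
  obtain s n where s: "s \<in> ?H" "s \<notin> P" and dvd: "dvd_in ?H (const_of u) (s * const_of w ^ n)"
    using min_prime_dvd_power[OF P mem one_div_closed_submonoid mult_div_closed_submonoid]
    by blast
  from dvd obtain h where h: "h \<in> ?H" "s * const_of w ^ n = h * const_of u"
    unfolding dvd_in_def by blast
  \<comment> \<open>Evaluation at \<open>c\<close> moves the divisibility into \<open>R\<close>,
    where the prime \<open>u\<close> divides no power of \<open>w\<close> and so must divide the
    value of \<open>s\<close>.\<close>
  have "u dvd int_value s c" for c
  proof -
    have "int_value s c * w ^ n = int_value (s * const_of w ^ n) c"
      using s by (simp add: int_value_mult int_value_power power_Int_polys div_closed_submonoid_Int_polys)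
    also have "\<dots> = int_value h c * u"
      using h by (simp add: int_value_mult div_closed_submonoid_Int_polys)
    finally have "int_value s c * w ^ n = int_value h c * u" .
    then have "u dvd int_value s c * w ^ n" by simp
    then show ?thesis
      using u ndvd prime_elem_dvd_mult_iff prime_elem_dvd_power by metis
  qed
  then have "dvd_in ?H (const_of u) s"
    using prime_elem_not_zeroI[OF u] by (simp add: div_closed_submonoid_dvd_const_iff s)
  then have "s \<in> P"
    using s_ideal_mult[OF ideal mem(1)] by (auto simp: dvd_in_def mult.commute)
  then show False using s by simp
qed

section \<open>The fixed divisor\<close>

text \<open>The powers of \<open>p\<close> are distinct because \<open>multiplicity\<close> recovers
  the exponent. Infinitely many points are what guarantees a nonzero value of a nonzero
  polynomial.\<close>

lemma infinite_UNIV_if_prime_elem: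
  fixes p :: "'a::factorial_semiring"
  assumes "prime_elem p"
  shows "infinite (UNIV :: 'a set)"
proof -
  have "inj (\<lambda>n. p ^ n)"
  proof (rule injI)
    fix m n assume "p ^ m = p ^ n"
    then have "multiplicity p (p ^ m) = multiplicity p (p ^ n)" by simp
    then show "m = n" using assms by (simp add: prime_elem_not_unit prime_elem_not_zeroI)
  qed
  then show ?thesis using finite_subset[OF subset_UNIV] range_inj_infinite by blast
qed

lemma exists_int_value_nonzero:
  fixes g :: "'a::idom fract poly"
  assumes "infinite (UNIV :: 'a set)" "g \<in> Int_polys" "g \<noteq> 0"
  shows "\<exists>c. int_value g c \<noteq> 0"
proof (rule ccontr)
  assume "\<not> ?thesis"
  then have "poly g (to_fract c) = 0" for c :: 'a
    using to_fract_int_value[OF assms(2), of c] by simp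
  then have "range to_fract \<subseteq> {x. poly g x = 0}" by auto
  then have "finite (range (to_fract :: 'a \<Rightarrow> _))"
    using poly_roots_finite[OF assms(3)] finite_subset by blast
  moreover have "inj (to_fract :: 'a \<Rightarrow> _)" by (auto intro: injI)
  ultimately show False using assms(1) finite_imageD by blast
qed

lemma min_val_eq_INF:
  assumes "g \<in> Int_polys"
  shows "min_val p g = (INF c. padic_val p (int_value g c))"
proof -
  have "{padic_val p r | r c. to_fract r = poly g (to_fract c)} =
      range (\<lambda>c. padic_val p (int_value g c))"
    using to_fract_int_value[OF assms] int_value_eqI by (fastforce simp: image_def)
  then show ?thesis by (simp add: min_val_def)
qed

section \<open>Factorization over the chosen primes\<close>

lemma prime_representatives_eqI:
  fixes Q :: "'a::factorial_semiring set"
  assumes Q: "prime_representatives Q" and p: "p \<in> Q" and q: "q \<in> Q" and dvd: "p dvd q"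
  shows "p = q"
proof -
  have prime: "prime_elem p" "prime_elem q" using Q p q by (auto simp: prime_representatives_def)
  then have "q dvd p"
    using dvd irreducibleD'[of q p] prime_elem_imp_irreducible prime_elem_not_unit by blast
  then have "q \<in> Q \<and> p dvd q \<and> q dvd p" "p \<in> Q \<and> p dvd p \<and> p dvd p" using p q dvd by auto
  then show ?thesis using Q prime(1) unfolding prime_representatives_def by metis
qed

text \<open>Distinct representatives are not associated, so \<open>normalize\<close> embeds them
  into the finite set of prime factors of \<open>r\<close>.\<close>

lemma finite_prime_representatives_dvd:
  fixes Q :: "'a::factorial_semiring set"
  assumes Q: "prime_representatives Q" and r: "r \<noteq> 0"
  shows "finite {p \<in> Q. p dvd r}"
proof (rule finite_imageD)
  have "normalize ` {p \<in> Q. p dvd r} \<subseteq> prime_factors r"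
    using Q r by (auto simp: prime_representatives_def prime_factors_dvd)
  then show "finite (normalize ` {p \<in> Q. p dvd r})" by (rule finite_subset) simp
  show "inj_on normalize {p \<in> Q. p dvd r}"
    by (rule inj_onI) (use prime_representatives_eqI[OF Q] in \<open>auto dest: associatedD1\<close>)
qed

lemma padic_val_eq_0: "\<not> p dvd r \<Longrightarrow> padic_val p r = 0"
  by (auto simp: padic_val_def not_dvd_imp_multiplicity_0 zero_enat_def)

lemma
  fixes Q :: "'a::{factorial_semiring, idom} set"
  assumes Q: "prime_representatives Q" and g: "g \<in> Int_polys" "g \<noteq> 0"
  shows fixed_div_nonzero: "fixed_div Q g \<noteq> 0"
    and multiplicity_fixed_div: "p \<in> Q \<Longrightarrow> enat (multiplicity p (fixed_div Q g)) = min_val p g"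
proof -
  define S where "S = {p \<in> Q. min_val p g \<noteq> 0}"
  define n where "n p = the_enat (min_val p g)" for p
  have fixed_div: "fixed_div Q g = (\<Prod>q \<in> S. q ^ n q)"
    by (simp add: fixed_div_def S_def n_def)
  have prime: "prime_elem q" if "q \<in> Q" for q
    using Q that by (simp add: prime_representatives_def)
  \<comment> \<open>If \<open>S\<close> were infinite, the product would be 1 by convention, so no
    nonzero value of \<open>g\<close> has to be found here.\<close>
  show "fixed_div Q g \<noteq> 0"
    using prime prime_elem_not_zeroI unfolding fixed_div
    by (cases "finite S") (auto simp: S_def)
  assume p: "p \<in> Q"
  obtain c where c: "int_value g c \<noteq> 0"
    using exists_int_value_nonzero[OF infinite_UNIV_if_prime_elem[OF prime[OF p]] g] by blast
  have le: "min_val q g \<le> padic_val q (int_value g c)" for q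
    unfolding min_val_eq_INF[OF g(1)] by (rule INF_lower) simp
  \<comment> \<open>A prime with positive minimal valuation divides every value, in particular the
    nonzero value at the chosen \<open>c\<close>. This bounds \<open>S\<close> by a finite
    set.\<close>
  have "S \<subseteq> {q \<in> Q. q dvd int_value g c}"
  proof
    fix q assume "q \<in> S"
    then show "q \<in> {q \<in> Q. q dvd int_value g c}"
      using le[of q] padic_val_eq_0[of q "int_value g c"] by (fastforce simp: S_def)
  qed
  then have fin: "finite S" using finite_prime_representatives_dvd[OF Q c] finite_subset by blast
  have "multiplicity p (fixed_div Q g) = (\<Sum>q \<in> S. multiplicity p (q ^ n q))"
    unfolding fixed_div
  proof (rule prime_elem_multiplicity_prod_distrib)
    show "0 \<notin> (\<lambda>q. q ^ n q) ` S"
      using prime prime_elem_not_zeroI by (fastforce simp: S_def)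
  qed (use fin prime p in auto)
  also have "\<dots> = (\<Sum>q \<in> S. if q = p then n q else 0)"
  proof (rule sum.cong)
    fix q assume "q \<in> S"
    then have q: "q \<in> Q" by (simp add: S_def)
    show "multiplicity p (q ^ n q) = (if q = p then n q else 0)"
    proof (cases "q = p")
      case True
      then show ?thesis using prime[OF p] by (simp add: prime_elem_not_unit prime_elem_not_zeroI)
    next
      case False
      then have "\<not> p dvd q ^ n q"
        using prime_representatives_eqI[OF Q p q] prime_elem_dvd_power[OF prime[OF p]] by blast
      then show ?thesis using False by (simp add: not_dvd_imp_multiplicity_0)
    qed
  qed simp
  also have "\<dots> = n p"
  proof -
    have "n p = 0" if "p \<notin> S" using that p by (simp add: S_def n_def zero_enat_def)
    then show ?thesis using fin by simp
  qed
  finally have "multiplicity p (fixed_div Q g) = n p" .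
  \<comment> \<open>The nonzero value at \<open>c\<close> bounds the minimum, so
    \<open>the_enat\<close> in the exponent loses no information.\<close>
  moreover have "min_val p g \<noteq> \<infinity>" using le[of p] c by (cases "min_val p g") (auto simp: padic_val_def)
  ultimately show "enat (multiplicity p (fixed_div Q g)) = min_val p g"
    by (auto simp: n_def)
qed

text \<open>Multiplicity depends only on the associate class of the prime, so testing at the
  representatives is enough. The infinite valuation of 0 covers \<open>v = 0\<close>.\<close>

lemma dvd_iff_prime_representatives:
  fixes u v :: "'a::{factorial_semiring, idom}"
  assumes Q: "prime_representatives Q" and u: "u \<noteq> 0"
  shows "u dvd v \<longleftrightarrow> (\<forall>p \<in> Q. enat (multiplicity p u) \<le> padic_val p v)"
proof (cases "v = 0")
  case True
  then show ?thesis by (simp add: padic_val_def)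
next
  case False
  have "u dvd v" if le: "\<forall>p \<in> Q. multiplicity p u \<le> multiplicity p v"
  proof (rule multiplicity_le_imp_dvd)
    fix p :: 'a assume "prime p"
    then have "\<exists>!q. q \<in> Q \<and> p dvd q \<and> q dvd p"
      using Q by (simp add: prime_representatives_def)
    then obtain q where "q \<in> Q" "p dvd q" "q dvd p" by (elim ex1E conjE)
    then have eq: "normalize p = normalize q" by (intro associatedI)
    have "multiplicity p x = multiplicity q x" for x
      by (metis multiplicity_normalize_left eq)
    then show "multiplicity p u \<le> multiplicity p v" using le \<open>q \<in> Q\<close> by simp
  qed (use u in simp)
  then show ?thesis using False by (auto simp: padic_val_def dvd_imp_multiplicity_le)
qed

text \<open>A multiplicity is at most the minimal valuation iff it is at most the valuation of each
  value. Exchanging the quantifiers over primes and points then gives divisibility of every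
  value.\<close>

lemma dvd_fixed_div_iff:
  assumes Q: "prime_representatives Q" and g: "g \<in> Int_polys" "g \<noteq> 0"
  shows "u dvd fixed_div Q g \<longleftrightarrow> u \<noteq> 0 \<and> (\<forall>c. u dvd int_value g c)"
proof (cases "u = 0")
  case True
  then show ?thesis using fixed_div_nonzero[OF assms] by simp
next
  case False
  have "u dvd fixed_div Q g \<longleftrightarrow> (\<forall>p \<in> Q. enat (multiplicity p u) \<le> min_val p g)"
    using fixed_div_nonzero[OF assms] multiplicity_fixed_div[OF assms]
    by (simp add: dvd_iff_prime_representatives[OF Q False] padic_val_def)
  also have "\<dots> \<longleftrightarrow> (\<forall>c. u dvd int_value g c)"
    by (auto simp: min_val_eq_INF[OF g(1)] le_INF_iff dvd_iff_prime_representatives[OF Q False])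
  finally show ?thesis using False by simp
qed

theorem lemma3p1:
  fixes f :: "'a::{factorial_semiring, idom} fract poly" and Q :: "'a set"
  assumes "prime_representatives Q"
    and "f \<in> Int_polys - {0}"
  shows "(\<forall>g \<in> div_closed_submonoid f. \<forall>u :: 'a.
            dvd_in (div_closed_submonoid f) (const_of u) g \<longleftrightarrow> u dvd fixed_div Q g) \<and>
         (atoms_in (div_closed_submonoid f) \<inter> range const_of
            = div_closed_submonoid f \<inter> const_of ` {u. irreducible u} \<and>
          div_closed_submonoid f \<inter> const_of ` {u. irreducible u}
            = const_of ` {u. irreducible u \<and> u dvd fixed_div Q f}) \<and>
         (\<forall>u \<in> atoms_in (div_closed_submonoid f) \<inter> range const_of.
            radical_s_ideal (div_closed_submonoid f) ((\<lambda>h. u * h) ` div_closed_submonoid f)) \<and>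
         (\<forall>P \<in> min_primes (div_closed_submonoid f).
            \<forall>u \<in> P \<inter> const_of ` {u. irreducible u}.
            \<forall>w \<in> P \<inter> const_of ` {u. irreducible u}.
              assoc_in (div_closed_submonoid f) u w)"
proof -
  let ?H = "div_closed_submonoid f"
  note prime = irreducible_imp_prime_elem
  have part1: "dvd_in ?H (const_of u) g \<longleftrightarrow> u dvd fixed_div Q g" if "g \<in> ?H" for g u
    using that assms(1)
    by (simp add: div_closed_submonoid_dvd_const_iff dvd_fixed_div_iff div_closed_submonoid_Int_polys)
  have atoms: "atoms_in ?H \<inter> range const_of = ?H \<inter> const_of ` {u. irreducible u}"
    by (auto simp: const_of_atom_iff)
  have "const_of u \<in> ?H \<longleftrightarrow> u dvd fixed_div Q f" if "irreducible u" for u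
    using prime_const_of_mem_iff[OF assms(2) prime[OF that]] assms that
    by (simp add: dvd_fixed_div_iff irreducible_def)
  then have part2: "?H \<inter> const_of ` {u. irreducible u}
      = const_of ` {u. irreducible u \<and> u dvd fixed_div Q f}"
    by auto
  have part3: "radical_s_ideal ?H ((\<lambda>h. u * h) ` ?H)" if "u \<in> atoms_in ?H \<inter> range const_of" for u
    using that unfolding atoms by (auto intro: radical_prime_const prime)
  have part4: "assoc_in ?H (const_of u) (const_of w)"
    if P: "P \<in> min_primes ?H" and mem: "const_of u \<in> P" "const_of w \<in> P"
      and irred: "irreducible u" "irreducible w" for P u w
  proof -
    have "u dvd w" "w dvd u"
      using prime_const_dvd_if_min_prime[OF P] mem irred prime by blast+
    \<comment> \<open>Mutual divisibility in \<open>R\<close> gives a unit factor in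
      \<open>R\<close>, whose image is a unit of the monoid.\<close>
    then obtain e where "is_unit e" "u = w * e"
      by (metis associatedI associatedE1 mult.commute)
    then show ?thesis
      by (auto simp: assoc_in_def const_of_mult const_of_unit_iff intro!: bexI[of _ "const_of e"])
  qed
  show ?thesis
  proof (intro conjI ballI allI)
    fix P u w
    assume "P \<in> min_primes ?H"
      and "u \<in> P \<inter> const_of ` {u. irreducible u}" "w \<in> P \<inter> const_of ` {u. irreducible u}"
    then show "assoc_in ?H u w" using part4 by auto
  qed (fact part1 atoms part2 part3)+
qed

end
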